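(* Let $B$ be a complete Boolean algebra. Then none of the following modal schemata is contained in $T_H(M_B)$, i.e. for each of them there is a modal formula $\varphi$ such that the corresponding instance does not belong to $T_H(M_B)$: (T) $\Box\varphi\to\varphi$; (M) $\Box\varphi\to\Diamond\varphi$; (Grz) $\Box\bigl(\Box(\varphi\to\Box\varphi)\to\varphi\bigr)\to\varphi$.
   Context: Boolean-valued models. For a complete Boolean algebra $B$ (bottom $0$, top $1$, complement $a^\ast$, $a\to b:=a^\ast\vee b$), define by transfinite recursion $V^{(B)}_\alpha=\{x: x$ is a function, $\mathrm{ran}(x)\subseteq B$, and $\mathrm{dom}(x)\subseteq V^{(B)}_\xi$ for some $\xi<\alpha\}$ and $V^{(B)}=\bigcup_\alpha V^{(B)}_\alpha$. Let $L_\in$ be the first-order language of set theory and $L_B$ its expansion by a constant symbol for each element of $V^{(B)}$. The Boolean value $\llbracket\cdot\rrbracket_B$ of $L_B$-sentences is defined recursively by $\llbracket u\in v\rrbracket_B=\bigvee_{x\in\mathrm{dom}(v)}(v(x)\wedge\llbracket x=u\rrbracket_B)$, $\llbracket u=v\rrbracket_B=\bigwedge_{x\in\mathrm{dom}(u)}(u(x)\to\llbracket x\in v\rrbracket_B)\wedge\bigwedge_{y\in\mathrm{dom}(v)}(v(y)\to\llbracket y\in u\rrbracket_B)$, the Boolean operations for the connectives, and meets (resp. joins) over $V^{(B)}$ for $\forall$ (resp. $\exists$). Internal modal semantics. $\mathsf{Sent}_{\in}$ is the (countable) set of parameter-free $L_\in$-sentences; its elements are used as the atomic propositions of the propositional modal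 language with $\neg,\wedge,\vee,\to,\Box,\Diamond$. On $B$ let $aRb\iff a\wedge b\neq 0$. Satisfaction in $M_B=\langle B,R,\llbracket\cdot\rrbracket_B\rangle$ at states $b\in B$ (including $b=0$): $M_B,b\models p$ iff $b\le\llbracket p\rrbracket_B$ for $p\in\mathsf{Sent}_{\in}$; modal-language Boolean connectives are interpreted classically at each state; $M_B,b\models\Box\varphi$ iff $M_B,a\models\varphi$ for all $a\in B$ with $bRa$; $M_B,b\models\Diamond\varphi$ iff $M_B,a\models\varphi$ for some $a\in B$ with $bRa$. $T_H(M_B)$ is the set of modal formulas $\varphi$ with $M_B,b\models\varphi$ for all $b\in B$. *)

theory Defs
  imports Main "HOL-Library.Multiset"
begin

section \<open>The universe of sets\<close>

text \<open>
  HOL has no type of all sets, so the universe \<open>V\<close> of the set-theoretic metatheory is a type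
  carrying a membership structure (\<open>elts y\<close> is the collection of all \<open>x\<close> with
  \<open>x \<in> y\<close>) that satisfies the axioms of ZFC. Separation and Replacement are stated for
  arbitrary HOL predicates and functions; the axiom of choice then follows from choice in HOL.
\<close>

class zfc_universe =
  fixes elts :: "'a \<Rightarrow> 'a set"
  assumes extensionality: "elts x = elts y \<Longrightarrow> x = y"
    and foundation: "wf {(x, y). x \<in> elts y}"
    and separation: "X \<subseteq> elts a \<Longrightarrow> \<exists>y. elts y = X"
    and pairing: "\<exists>y. elts y = {a, b}"
    and union: "\<exists>y. elts y = (\<Union>x\<in>elts a. elts x)"
    and power_set: "\<exists>y. elts y = {x. elts x \<subseteq> elts a}"
    and replacement: "\<exists>y. elts y = f ` elts a"
    and infinity: "\<exists>w. (\<exists>e\<in>elts w. elts e = {}) \<and>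
      (\<forall>x\<in>elts w. \<exists>y\<in>elts w. elts y = insert x (elts x))"

definition is_pair :: "'v::zfc_universe \<Rightarrow> 'v \<Rightarrow> 'v \<Rightarrow> bool" where
  "is_pair p x y \<longleftrightarrow> (\<exists>s t. elts p = {s, t} \<and> elts s = {x} \<and> elts t = {x, y})"

definition dom_set :: "'v::zfc_universe \<Rightarrow> 'v set" where
  "dom_set f = {x. \<exists>p\<in>elts f. \<exists>y. is_pair p x y}"

definition ran_set :: "'v::zfc_universe \<Rightarrow> 'v set" where
  "ran_set f = {y. \<exists>p\<in>elts f. \<exists>x. is_pair p x y}"

definition is_function :: "'v::zfc_universe \<Rightarrow> bool" where
  "is_function f \<longleftrightarrow> (\<forall>p\<in>elts f. \<exists>x y. is_pair p x y) \<and>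
     (\<forall>p\<in>elts f. \<forall>q\<in>elts f. \<forall>x y z. is_pair p x y \<longrightarrow> is_pair q x z \<longrightarrow> y = z)"

definition transitive :: "'v::zfc_universe \<Rightarrow> bool" where
  "transitive x \<longleftrightarrow> (\<forall>y\<in>elts x. elts y \<subseteq> elts x)"

definition ordinal :: "'v::zfc_universe \<Rightarrow> bool" where
  "ordinal x \<longleftrightarrow> transitive x \<and> (\<forall>y\<in>elts x. transitive y)"


section \<open>The Boolean-valued universe\<close>

text \<open>
  The complete Boolean algebra \<open>B\<close> is a type of sort \<open>{complete_lattice, boolean_algebra}\<close>.
  (The library class \<open>complete_boolean_algebra\<close> is unsuitable: it also demands complete
  distributivity, so its instances are only the power set algebras.) That \<open>B\<close> is a set
  of \<open>V\<close> is expressed by an injection \<open>emb\<close> from \<open>B\<close> to \<open>V\<close> whose range is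
  the collection of elements of some member of \<open>V\<close>; functions in \<open>V\<close> with values
  in \<open>B\<close> are functions in \<open>V\<close> with values in the range of \<open>emb\<close>.
\<close>

function VB_stage ::
    "('b::{complete_lattice,boolean_algebra} \<Rightarrow> 'v::zfc_universe) \<Rightarrow> 'v \<Rightarrow> 'v set" where
  "VB_stage emb \<alpha> = {x. is_function x \<and> ran_set x \<subseteq> range emb \<and>
     (\<exists>\<xi>\<in>elts \<alpha>. dom_set x \<subseteq> VB_stage emb \<xi>)}"
  by auto
termination
  by (relation "inv_image {(x, y). x \<in> elts y} snd") (auto simp: foundation)

declare VB_stage.simps [simp del]

definition VB :: "('b::{complete_lattice,boolean_algebra} \<Rightarrow> 'v::zfc_universe) \<Rightarrow> 'v set" where
  "VB emb = (\<Union>\<alpha>\<in>{\<alpha>. ordinal \<alpha>}. VB_stage emb \<alpha>)"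

definition val :: "('b::{complete_lattice,boolean_algebra} \<Rightarrow> 'v::zfc_universe) \<Rightarrow> 'v \<Rightarrow> 'v \<Rightarrow> 'b" where
  "val emb f x = (THE b. \<exists>p\<in>elts f. is_pair p x (emb b))"

definition bimp :: "'b::boolean_algebra \<Rightarrow> 'b \<Rightarrow> 'b" where
  "bimp a b = sup (- a) b"

lemma dom_set_descends:
  assumes "x \<in> dom_set u"
  shows "(x, u) \<in> {(x, y). x \<in> elts y}\<^sup>+"
proof -
  obtain p y s t where "p \<in> elts u" "elts p = {s, t}" "elts s = {x}"
    using assms by (auto simp: dom_set_def is_pair_def)
  then have "(x, s) \<in> {(x, y). x \<in> elts y}" "(s, p) \<in> {(x, y). x \<in> elts y}"
    "(p, u) \<in> {(x, y). x \<in> elts y}"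
    by auto
  then show ?thesis
    by (meson r_into_trancl trancl_into_trancl)
qed

lemma mset_pair_decreases:
  assumes "(x, u) \<in> r"
  shows "({#x, v#}, {#u, v#}) \<in> mult r" "({#x, v#}, {#v, u#}) \<in> mult r"
proof -
  have "({#v#} + {#x#}, {#v#} + {#u#}) \<in> mult r"
    by (rule one_step_implies_mult) (use assms in auto)
  then show "({#x, v#}, {#u, v#}) \<in> mult r" "({#x, v#}, {#v, u#}) \<in> mult r"
    by (simp_all add: add_mset_commute)
qed

function mem_val eq_val ::
    "('b::{complete_lattice,boolean_algebra} \<Rightarrow> 'v::zfc_universe) \<Rightarrow> 'v \<Rightarrow> 'v \<Rightarrow> 'b" where
  "mem_val emb u v = (SUP x\<in>dom_set v. inf (val emb v x) (eq_val emb x u))"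
| "eq_val emb u v =
     inf (INF x\<in>dom_set u. bimp (val emb u x) (mem_val emb x v))
         (INF y\<in>dom_set v. bimp (val emb v y) (mem_val emb y u))"
  by pat_completeness auto
termination
proof (relation "inv_image (mult ({(x, y). x \<in> elts y}\<^sup>+))
    (case_sum (\<lambda>(_, u, v). {#u, v#}) (\<lambda>(_, u, v). {#u, v#}))", goal_cases)
  case 1
  show ?case
    by (intro wf_inv_image wf_mult wf_trancl foundation)
qed (auto intro: mset_pair_decreases dom_set_descends)

declare mem_val.simps [simp del] eq_val.simps [simp del]


section \<open>The first-order language\<close>

text \<open>
  \<open>'c fm\<close> are the formulas of the language of set theory with a constant symbol for each
  element of \<open>'c\<close>; \<open>set_fm \<phi>\<close> is the set of constants occurring in \<open>\<phi>\<close>.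
\<close>

datatype 'c trm = Var nat | Cst (the_const: 'c)

datatype 'c fm =
    Mem "'c trm" "'c trm"
  | Eq "'c trm" "'c trm"
  | Neg "'c fm"
  | Conj "'c fm" "'c fm"
  | Disj "'c fm" "'c fm"
  | Impl "'c fm" "'c fm"
  | All nat "'c fm"
  | Ex nat "'c fm"

fun fv_trm :: "'c trm \<Rightarrow> nat set" where
  "fv_trm (Var n) = {n}"
| "fv_trm (Cst c) = {}"

fun fv :: "'c fm \<Rightarrow> nat set" where
  "fv (Mem s t) = fv_trm s \<union> fv_trm t"
| "fv (Eq s t) = fv_trm s \<union> fv_trm t"
| "fv (Neg \<phi>) = fv \<phi>"
| "fv (Conj \<phi> \<psi>) = fv \<phi> \<union> fv \<psi>"
| "fv (Disj \<phi> \<psi>) = fv \<phi> \<union> fv \<psi>"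
| "fv (Impl \<phi> \<psi>) = fv \<phi> \<union> fv \<psi>"
| "fv (All n \<phi>) = fv \<phi> - {n}"
| "fv (Ex n \<phi>) = fv \<phi> - {n}"

fun subst_trm :: "nat \<Rightarrow> 'c \<Rightarrow> 'c trm \<Rightarrow> 'c trm" where
  "subst_trm n c (Var m) = (if m = n then Cst c else Var m)"
| "subst_trm n c (Cst d) = Cst d"

fun subst :: "nat \<Rightarrow> 'c \<Rightarrow> 'c fm \<Rightarrow> 'c fm" where
  "subst n c (Mem s t) = Mem (subst_trm n c s) (subst_trm n c t)"
| "subst n c (Eq s t) = Eq (subst_trm n c s) (subst_trm n c t)"
| "subst n c (Neg \<phi>) = Neg (subst n c \<phi>)"
| "subst n c (Conj \<phi> \<psi>) = Conj (subst n c \<phi>) (subst n c \<psi>)"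
| "subst n c (Disj \<phi> \<psi>) = Disj (subst n c \<phi>) (subst n c \<psi>)"
| "subst n c (Impl \<phi> \<psi>) = Impl (subst n c \<phi>) (subst n c \<psi>)"
| "subst n c (All m \<phi>) = All m (if m = n then \<phi> else subst n c \<phi>)"
| "subst n c (Ex m \<phi>) = Ex m (if m = n then \<phi> else subst n c \<phi>)"

lemma size_subst_trm [simp]: "size (subst_trm n c t) = size t"
  by (cases t) auto

lemma size_subst [simp]: "size (subst n c \<phi>) = size \<phi>"
  by (induction \<phi>) auto

definition Sent :: "'c fm set" where
  "Sent = {\<phi>. set_fm \<phi> = {} \<and> fv \<phi> = {}}"

text \<open>
  The value is meaningful for sentences with constants from \<open>VB emb\<close>; on an atomic formula
  with a free variable it is an unspecified element.
\<close>

function bval ::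
    "('b::{complete_lattice,boolean_algebra} \<Rightarrow> 'v::zfc_universe) \<Rightarrow> 'v fm \<Rightarrow> 'b" where
  "bval emb (Mem s t) = mem_val emb (the_const s) (the_const t)"
| "bval emb (Eq s t) = eq_val emb (the_const s) (the_const t)"
| "bval emb (Neg \<phi>) = - bval emb \<phi>"
| "bval emb (Conj \<phi> \<psi>) = inf (bval emb \<phi>) (bval emb \<psi>)"
| "bval emb (Disj \<phi> \<psi>) = sup (bval emb \<phi>) (bval emb \<psi>)"
| "bval emb (Impl \<phi> \<psi>) = bimp (bval emb \<phi>) (bval emb \<psi>)"
| "bval emb (All n \<phi>) = (INF a\<in>VB emb. bval emb (subst n a \<phi>))"
| "bval emb (Ex n \<phi>) = (SUP a\<in>VB emb. bval emb (subst n a \<phi>))"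
  by pat_completeness auto
termination
  by (relation "measure (size \<circ> snd)") auto


section \<open>The modal language and its semantics\<close>

datatype 'p mfm =
    Atom 'p
  | MNot "'p mfm"
  | MAnd "'p mfm" "'p mfm"
  | MOr "'p mfm" "'p mfm"
  | MImp "'p mfm" "'p mfm"  (infixr \<open>\<^bold>\<longrightarrow>\<close> 55)
  | Box "'p mfm"  (\<open>\<box> _\<close> [90] 90)
  | Dia "'p mfm"  (\<open>\<diamond> _\<close> [90] 90)

definition modal_formulas :: "'c fm mfm set" where
  "modal_formulas = {\<phi>. set_mfm \<phi> \<subseteq> Sent}"

definition acc :: "'b::boolean_algebra \<Rightarrow> 'b \<Rightarrow> bool" where
  "acc a b \<longleftrightarrow> inf a b \<noteq> bot"

primrec sat ::
    "('b::{complete_lattice,boolean_algebra} \<Rightarrow> 'v::zfc_universe) \<Rightarrow> 'b \<Rightarrow> 'v fm mfm \<Rightarrow> bool" where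
  "sat emb b (Atom p) \<longleftrightarrow> b \<le> bval emb p"
| "sat emb b (MNot \<phi>) \<longleftrightarrow> \<not> sat emb b \<phi>"
| "sat emb b (MAnd \<phi> \<psi>) \<longleftrightarrow> sat emb b \<phi> \<and> sat emb b \<psi>"
| "sat emb b (MOr \<phi> \<psi>) \<longleftrightarrow> sat emb b \<phi> \<or> sat emb b \<psi>"
| "sat emb b (\<phi> \<^bold>\<longrightarrow> \<psi>) \<longleftrightarrow> (sat emb b \<phi> \<longrightarrow> sat emb b \<psi>)"
| "sat emb b (\<box> \<phi>) \<longleftrightarrow> (\<forall>a. acc b a \<longrightarrow> sat emb a \<phi>)"
| "sat emb b (\<diamond> \<phi>) \<longleftrightarrow> (\<exists>a. acc b a \<and> sat emb a \<phi>)"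

definition T_H ::
    "('b::{complete_lattice,boolean_algebra} \<Rightarrow> 'v::zfc_universe) \<Rightarrow> 'v fm mfm set" where
  "T_H emb = {\<phi> \<in> modal_formulas. \<forall>b. sat emb b \<phi>}"

end

theory Submission
  imports Defs
begin

text \<open>
  The state \<open>0\<close> has no successors, so every \<open>\<box>\<close>-formula holds there and every
  \<open>\<diamond>\<close>-formula fails. Hence a contradiction is a counterexample to all three schemata.
\<close>

lemma not_acc_bot [simp]: "\<not> acc bot a"
  by (simp add: acc_def)

text \<open>Connectives are classical at each state, so an atom conjoined with its negation fails
  everywhere. A bare atom would not do: \<open>bot\<close> lies below every Boolean value, so all
  atoms hold at \<open>bot\<close>.\<close>

lemma contradiction_exists:
  "\<exists>\<phi>\<in>modal_formulas. \<forall>(emb :: 'b::{complete_lattice,boolean_algebra} \<Rightarrow> 'v::zfc_universe) b.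
     \<not> sat emb b \<phi>"
proof -
  \<comment> \<open>Any member of \<open>Sent\<close> serves; with no constants allowed, a closed
    formula needs a quantifier.\<close>
  define p :: "'v fm" where "p = All 0 (Eq (Var 0) (Var 0))"
  have "MAnd (Atom p) (MNot (Atom p)) \<in> modal_formulas"
    by (simp add: modal_formulas_def Sent_def p_def)
  then show ?thesis
    by (rule bexI[rotated]) simp
qed

theorem theorem4p2:
  fixes emb :: "'b::{complete_lattice,boolean_algebra} \<Rightarrow> 'v::zfc_universe"
  assumes "inj emb" and "\<exists>c. elts c = range emb"
  shows "(\<exists>\<phi>\<in>modal_formulas. (\<box> \<phi> \<^bold>\<longrightarrow> \<phi>) \<notin> T_H emb) \<and>
    (\<exists>\<phi>\<in>modal_formulas. (\<box> \<phi> \<^bold>\<longrightarrow> \<diamond> \<phi>) \<notin> T_H emb) \<and>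
    (\<exists>\<phi>\<in>modal_formulas. (\<box> (\<box> (\<phi> \<^bold>\<longrightarrow> \<box> \<phi>) \<^bold>\<longrightarrow> \<phi>) \<^bold>\<longrightarrow> \<phi>) \<notin> T_H emb)"
proof -
  obtain \<phi> :: "'v fm mfm" where \<phi>: "\<phi> \<in> modal_formulas" "\<not> sat emb bot \<phi>"
    using contradiction_exists by blast
  have not_valid: "\<psi> \<notin> T_H emb" if "\<not> sat emb bot \<psi>" for \<psi>
    using that by (auto simp: T_H_def)
  \<comment> \<open>At \<open>bot\<close> the outermost box of each antecedent is vacuously true, so
    the boxes nested in the third schema are never evaluated.\<close>
  have "(\<box> \<phi> \<^bold>\<longrightarrow> \<phi>) \<notin> T_H emb"
    "(\<box> \<phi> \<^bold>\<longrightarrow> \<diamond> \<phi>) \<notin> T_H emb"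
    "(\<box> (\<box> (\<phi> \<^bold>\<longrightarrow> \<box> \<phi>) \<^bold>\<longrightarrow> \<phi>) \<^bold>\<longrightarrow> \<phi>) \<notin> T_H emb"
    using \<phi>(2) by (auto intro!: not_valid)
  with \<phi>(1) show ?thesis
    by blast
qed

end
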